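(* For all integers $m \geq 3$ and $n \geq 1$, the tensor product $W_m \times K_{1,n}$ of the wheel $W_m$ and the star $K_{1,n}$ admits an antimagic labeling (i.e. is antimagic).
   Context: All graphs are finite, simple and undirected. Antimagic labeling: for a graph $G$ with $q = |E(G)|$ edges, an antimagic labeling is a bijection $f : E(G) \to \{1,2,\dots,q\}$ such that $\phi_f(u) \neq \phi_f(v)$ for all distinct $u,v \in V(G)$, where $\phi_f(u)$ is the sum of the labels $f(e)$ over all edges $e$ incident to $u$. $G$ is antimagic if it admits an antimagic labeling. Tensor product: $G \times H$ has vertex set $V(G) \times V(H)$, and $(x_1,y_1)$ is adjacent to $(x_2,y_2)$ if and only if $x_1x_2 \in E(G)$ and $y_1y_2 \in E(H)$. Star: $K_{1,n}$ is the complete bipartite graph with a central vertex adjacent to each of $n$ other vertices (and no other edges). Wheel: $W_m$ ($m\ge 3$) has vertices $u_0,u_1,\dots,u_m$; the vertices $u_1,\dots,u_m$ form a cycle $C_m$ with edges $u_iu_{i+1}$ ($1\le i\le m-1$) and $u_mu_1$, and the central vertex $u_0$ is adjacent to every $u_i$, $1\le i\le m$ (so $W_m$ has $m+1$ vertices and $2m$ edges). *)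

theory Defs
  imports Main
begin

record 'a sgraph =
  verts :: "'a set"
  edges :: "'a set set"

definition fin_simple_graph :: "'a sgraph \<Rightarrow> bool" where
  "fin_simple_graph G \<longleftrightarrow>
     finite (verts G) \<and> (\<forall>e \<in> edges G. e \<subseteq> verts G \<and> card e = 2)"

definition vertex_sum :: "'a sgraph \<Rightarrow> ('a set \<Rightarrow> nat) \<Rightarrow> 'a \<Rightarrow> nat" where
  "vertex_sum G f v = (\<Sum>e \<in> {e \<in> edges G. v \<in> e}. f e)"

definition antimagic_labeling :: "'a sgraph \<Rightarrow> ('a set \<Rightarrow> nat) \<Rightarrow> bool" where
  "antimagic_labeling G f \<longleftrightarrow>
     bij_betw f (edges G) {1..card (edges G)} \<and>
     (\<forall>u \<in> verts G. \<forall>v \<in> verts G. u \<noteq> v \<longrightarrow> vertex_sum G f u \<noteq> vertex_sum G f v)"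

definition antimagic :: "'a sgraph \<Rightarrow> bool" where
  "antimagic G \<longleftrightarrow> (\<exists>f. antimagic_labeling G f)"

definition tensor_product :: "'a sgraph \<Rightarrow> 'b sgraph \<Rightarrow> ('a \<times> 'b) sgraph" where
  "tensor_product G H =
     \<lparr> verts = verts G \<times> verts H,
       edges = {{(x1, y1), (x2, y2)} | x1 y1 x2 y2. {x1, x2} \<in> edges G \<and> {y1, y2} \<in> edges H} \<rparr>"

text \<open>The centre of the star and the hub of the wheel are the vertex \<open>0\<close>. For \<open>m < 3\<close> the
  wheel below is not meaningful (for \<open>m = 1\<close> the rim edge \<open>{m, 1}\<close> degenerates to a
  singleton).\<close>

definition star_graph :: "nat \<Rightarrow> nat sgraph" where
  "star_graph n = \<lparr> verts = {0..n}, edges = {{0, j} | j. 1 \<le> j \<and> j \<le> n} \<rparr>"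

definition wheel_graph :: "nat \<Rightarrow> nat sgraph" where
  "wheel_graph m =
     \<lparr> verts = {0..m},
       edges = {{0, i} | i. 1 \<le> i \<and> i \<le> m}
             \<union> {{i, i + 1} | i. 1 \<le> i \<and> i \<le> m - 1}
             \<union> {{m, 1}} \<rparr>"

lemma fin_simple_graph_star: "fin_simple_graph (star_graph n)"
  by (auto simp: fin_simple_graph_def star_graph_def card_2_iff)

lemma fin_simple_graph_wheel:
  assumes "m \<ge> 3"
  shows "fin_simple_graph (wheel_graph m)"
  using assms by (auto simp: fin_simple_graph_def wheel_graph_def)

lemma fin_simple_graph_tensor:
  assumes "fin_simple_graph G" and "fin_simple_graph H"
  shows "fin_simple_graph (tensor_product G H)"
proof -
  have "x1 \<noteq> x2" if "{x1, x2} \<in> edges G" for x1 x2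
    using assms(1) that by (force simp: fin_simple_graph_def)
  then have "card {(x1, y1), (x2, y2)} = 2" if "{x1, x2} \<in> edges G"
    for x1 x2 and y1 y2 :: 'b
    using that by auto
  then show ?thesis
    using assms by (fastforce simp: fin_simple_graph_def tensor_product_def)
qed

lemma tensor_product_adj:
  "{(x1, y1), (x2, y2)} \<in> edges (tensor_product G H) \<longleftrightarrow>
     {x1, x2} \<in> edges G \<and> {y1, y2} \<in> edges H"
  by (auto simp: tensor_product_def doubleton_eq_iff insert_commute)

end

theory Submission
  imports Defs
begin

text \<open>
  Write \<open>N = m * n\<close>. Each edge of the product joins some \<open>(a, 0)\<close> to some \<open>(b, j)\<close> with
  \<open>j \<ge> 1\<close> and \<open>a\<close>, \<open>b\<close> adjacent in the wheel, so edges are triples \<open>(a, b, j)\<close>. They fall into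
  four classes of \<open>N\<close> edges: those with \<open>a = 0\<close>, those with \<open>b = 0\<close>, and those that go forwards
  or backwards along the rim. The labels \<open>1, \<dots>, 4 N\<close> fall into four blocks of \<open>N\<close> consecutive
  numbers, and each class receives one block. The class \<open>a = 0\<close> takes the top block; the class
  \<open>b = 0\<close> takes the block with index \<open>c \<in> {0, 1, 2}\<close>, a parameter chosen at the end.

  In the two rim classes, the edges \<open>(i, i + 1, j)\<close> and \<open>(i, i - 1, j)\<close> get complementary
  positions in their blocks, so their labels add up to a constant. This has two effects.

  \<^item> The sum at \<open>(i, 0)\<close> depends only on the edges \<open>(i, 0, j)\<close>. Their labels run row by row
    through their block, so these sums form an arithmetic progression with difference \<open>n\<^sup>2\<close>.
    The blocks not at the top add up to the same total whichever one is singled out, so these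
    sums do not depend on \<open>c\<close>; they lie between \<open>4 N n\<close> and \<open>5 N n + n\<close>.

  \<^item> At \<open>(k, j)\<close> the two rim labels add up to a constant plus (position of \<open>k - 1\<close>) minus
    (position of \<open>k + 1\<close>). Giving the edge \<open>(0, k, j)\<close> position \<open>k + 1\<close> cancels the
    subtraction, and the sums at these vertices are exactly the \<open>N\<close> consecutive numbers
    above \<open>(7 - c) N + 1\<close>.

  The sums at the vertices \<open>(0, j)\<close> form an arithmetic progression with difference \<open>m\<close> near
  \<open>(c + 1/2) m N\<close>, and \<open>(0, 0)\<close> carries the whole top block, hence the largest sum. It remains
  to keep apart the three groups of vertices \<open>(i, 0)\<close>, \<open>(k, j)\<close>, \<open>(0, j)\<close>. The first two
  are disjoint for every \<open>c\<close>. Moving \<open>c\<close> shifts the third group by multiples of \<open>m N\<close>: it can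
  be put below both others (\<open>c = 0\<close>, small \<open>m\<close>), between them (\<open>c = 1\<close>, \<open>m \<le> 2 n\<close>) or above both
  (\<open>c = 2\<close>, \<open>m > 2 n\<close>). This is \<open>middle_block_separates\<close>.
\<close>

section \<open>Labelling the product of a graph with a star\<close>

definition neighbours :: "'a sgraph \<Rightarrow> 'a \<Rightarrow> 'a set" where
  "neighbours G a = {b. {a, b} \<in> edges G}"

definition star_arcs :: "'a sgraph \<Rightarrow> nat \<Rightarrow> ('a \<times> 'a \<times> nat) set" where
  "star_arcs G n = {(a, b, j). b \<in> neighbours G a \<and> j \<in> {1..n}}"

text \<open>
  Ordering the first two entries is what makes the encoding injective: a wheel edge \<open>{a, b}\<close>
  yields two different product edges over each leaf \<open>j\<close>, one for each choice of the endpoint that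
  is paired with the centre \<open>0\<close> of the star.
\<close>
definition arc_edge :: "'a \<times> 'a \<times> nat \<Rightarrow> ('a \<times> nat) set" where
  "arc_edge = (\<lambda>(a, b, j). {(a, 0), (b, j)})"

lemma neighbours_sym: "b \<in> neighbours G a \<longleftrightarrow> a \<in> neighbours G b"
  by (simp add: neighbours_def insert_commute)

lemma inj_on_arc_edge: "inj_on arc_edge (star_arcs G n)"
  by (auto simp: inj_on_def arc_edge_def star_arcs_def doubleton_eq_iff)

lemma edges_tensor_star: "edges (tensor_product G (star_graph n)) = arc_edge ` star_arcs G n"
proof (intro set_eqI iffI)
  fix e
  assume "e \<in> edges (tensor_product G (star_graph n))"
  then obtain x1 y1 x2 y2 j where e: "e = {(x1, y1), (x2, y2)}" "{x1, x2} \<in> edges G"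
    and j: "{y1, y2} = {0, j}" "j \<in> {1..n}"
    by (auto simp: tensor_product_def star_graph_def)
  from j(1) consider "y1 = 0" "y2 = j" | "y1 = j" "y2 = 0"
    by (auto simp: doubleton_eq_iff)
  then show "e \<in> arc_edge ` star_arcs G n"
  proof cases
    case 1
    then show ?thesis
      using e j(2)
      by (intro image_eqI[of _ _ "(x1, x2, j)"]) (auto simp: arc_edge_def star_arcs_def neighbours_def)
  next
    case 2
    then show ?thesis
      using e j(2)
      by (intro image_eqI[of _ _ "(x2, x1, j)"])
        (auto simp: arc_edge_def star_arcs_def neighbours_def insert_commute)
  qed
next
  fix e
  assume "e \<in> arc_edge ` star_arcs G n"
  then obtain a b j where "e = {(a, 0), (b, j)}" "{a, b} \<in> edges G" "j \<in> {1..n}"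
    by (auto simp: arc_edge_def star_arcs_def neighbours_def)
  then show "e \<in> edges (tensor_product G (star_graph n))"
    by (auto simp: tensor_product_adj star_graph_def)
qed

text \<open>
  Edges as two-element sets disappear here: a labelling of the arcs transfers to the edges, and the sum at
  a vertex over the centre of the star is a double sum, because each leaf contributes a copy of
  every neighbour, while over a leaf it is a single sum.
\<close>
lemma antimagic_tensor_star:
  fixes g :: "'a \<times> 'a \<times> nat \<Rightarrow> nat"
  assumes bij: "bij_betw g (star_arcs G n) {1..card (star_arcs G n)}"
    and inj: "inj_on (\<lambda>(a, j). if j = 0 then \<Sum>i = 1..n. \<Sum>b \<in> neighbours G a. g (a, b, i)
                              else \<Sum>b \<in> neighbours G a. g (b, a, j))
                (verts G \<times> {0..n})"
  shows "antimagic (tensor_product G (star_graph n))"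
proof -
  let ?T = "tensor_product G (star_graph n)"
  let ?A = "star_arcs G n"
  define f where "f = g \<circ> inv_into ?A arc_edge"
  have f_edge: "f (arc_edge x) = g x" if "x \<in> ?A" for x
    using that by (simp add: f_def inj_on_arc_edge)
  have "bij_betw (inv_into ?A arc_edge) (edges ?T) ?A"
    unfolding edges_tensor_star by (intro bij_betw_inv_into inj_on_imp_bij_betw inj_on_arc_edge)
  then have "bij_betw f (edges ?T) {1..card ?A}"
    unfolding f_def by (rule bij_betw_trans) (rule bij)
  moreover have "card (edges ?T) = card ?A"
    by (simp add: edges_tensor_star card_image inj_on_arc_edge)
  moreover
  have sum_arcs: "vertex_sum ?T f v = sum g {x \<in> ?A. v \<in> arc_edge x}" for v
  proof -
    have "{e \<in> edges ?T. v \<in> e} = arc_edge ` {x \<in> ?A. v \<in> arc_edge x}"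
      by (auto simp: edges_tensor_star)
    then have "vertex_sum ?T f v = sum (f \<circ> arc_edge) {x \<in> ?A. v \<in> arc_edge x}"
      unfolding vertex_sum_def
      by (simp add: sum.reindex inj_on_subset[OF inj_on_arc_edge[of G n]])
    also have "\<dots> = sum g {x \<in> ?A. v \<in> arc_edge x}"
      by (intro sum.cong) (auto simp: f_edge)
    finally show ?thesis .
  qed
  have centre: "vertex_sum ?T f (a, 0) = (\<Sum>i = 1..n. \<Sum>b \<in> neighbours G a. g (a, b, i))" for a
  proof -
    have "{x \<in> ?A. (a, 0) \<in> arc_edge x} = (\<lambda>(i, b). (a, b, i)) ` ({1..n} \<times> neighbours G a)"
      by (auto simp: star_arcs_def arc_edge_def)
    moreover have "inj_on (\<lambda>(i, b). (a, b, i)) ({1..n} \<times> neighbours G a)"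
      by (auto simp: inj_on_def)
    ultimately show ?thesis
      by (simp add: sum_arcs sum.reindex sum.cartesian_product o_def case_prod_unfold)
  qed
  have leaf: "vertex_sum ?T f (a, j) = (\<Sum>b \<in> neighbours G a. g (b, a, j))"
    if "j \<in> {1..n}" for a j
  proof -
    have "{x \<in> ?A. (a, j) \<in> arc_edge x} = (\<lambda>b. (b, a, j)) ` neighbours G a"
      using that neighbours_sym[of a G] by (auto simp: star_arcs_def arc_edge_def)
    then show ?thesis
      by (simp add: sum_arcs sum.reindex inj_on_def o_def)
  qed
  have "inj_on (vertex_sum ?T f) (verts ?T)"
  proof -
    have "verts ?T = verts G \<times> {0..n}"
      by (simp add: tensor_product_def star_graph_def)
    moreover have "inj_on (vertex_sum ?T f) (verts G \<times> {0..n})"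
      by (rule inj_on_cong[THEN iffD1, OF _ inj]) (auto simp: centre leaf)
    ultimately show ?thesis
      by simp
  qed
  ultimately show ?thesis
    unfolding antimagic_def antimagic_labeling_def by (auto dest: inj_onD)
qed

section \<open>Adjacency in the wheel\<close>

definition rim_succ :: "nat \<Rightarrow> nat \<Rightarrow> nat" where
  "rim_succ m i = (if i = m then 1 else i + 1)"

definition rim_pred :: "nat \<Rightarrow> nat \<Rightarrow> nat" where
  "rim_pred m i = (if i = 1 then m else i - 1)"

lemma rim_succ_in: "i \<in> {1..m} \<Longrightarrow> rim_succ m i \<in> {1..m}"
  and rim_pred_in: "i \<in> {1..m} \<Longrightarrow> rim_pred m i \<in> {1..m}"
  by (auto simp: rim_succ_def rim_pred_def)

lemma rim_succ_pred: "i \<in> {1..m} \<Longrightarrow> rim_succ m (rim_pred m i) = i"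
  by (auto simp: rim_succ_def rim_pred_def)

lemma rim_succ_neq_pred: "m \<ge> 3 \<Longrightarrow> i \<in> {1..m} \<Longrightarrow> rim_succ m i \<noteq> rim_pred m i"
  by (auto simp: rim_succ_def rim_pred_def)

lemma neighbours_wheel_hub: "neighbours (wheel_graph m) 0 = {1..m}" if "m \<ge> 3"
  using that by (auto simp: neighbours_def wheel_graph_def doubleton_eq_iff)

lemma neighbours_wheel_rim:
  "neighbours (wheel_graph m) i = {0, rim_succ m i, rim_pred m i}" if "m \<ge> 3" "i \<in> {1..m}"
proof -
  have "{i, b} \<in> edges (wheel_graph m) \<longleftrightarrow>
      b = 0 \<or> (b = i + 1 \<and> i < m) \<or> (i = b + 1 \<and> b \<ge> 1) \<or> (i = m \<and> b = 1) \<or> (i = 1 \<and> b = m)"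
    (is "_ \<longleftrightarrow> ?adj b") for b
    using that by (auto simp: wheel_graph_def doubleton_eq_iff)
  moreover have "?adj b \<longleftrightarrow> b = 0 \<or> b = rim_succ m i \<or> b = rim_pred m i" for b
    using that unfolding rim_succ_def rim_pred_def atLeastAtMost_iff by (split if_split)+ linarith
  ultimately show ?thesis
    by (simp only: set_eq_iff neighbours_def mem_Collect_eq insert_iff empty_iff simp_thms)
qed

lemma neighbours_wheel_outside:
  "neighbours (wheel_graph m) i = {}" if "m \<ge> 3" "i > m"
  using that by (auto simp: neighbours_def wheel_graph_def doubleton_eq_iff)

section \<open>The labelling\<close>

text \<open>
  The last two lines use complementary positions, which makes the sum of the labels of
  \<open>(i, i + 1, j)\<close> and \<open>(i, i - 1, j)\<close> constant. The first line places the arc to \<open>b\<close> at the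
  position of the successor of \<open>b\<close>, to compensate the label of the arc from that successor back
  to \<open>b\<close>. The parameter \<open>c\<close> is the index of the block given to the arcs into copies of the hub.
\<close>
definition wheel_star_label :: "nat \<Rightarrow> nat \<Rightarrow> nat \<Rightarrow> nat \<times> nat \<times> nat \<Rightarrow> nat" where
  "wheel_star_label m n c = (\<lambda>(a, b, j).
     if a = 0 then 3 * (m * n) + (j - 1) * m + rim_succ m b
     else if b = 0 then c * (m * n) + (a - 1) * n + j
     else if b = rim_succ m a then (c + 1) mod 3 * (m * n) + (j - 1) * m + a
     else (c + 2) mod 3 * (m * n) + (m * n + 1 - ((j - 1) * m + a)))"

lemma digits_le: "(j - 1) * m + i \<le> m * n" if "i \<in> {1..m}" "j \<in> {1..n}" for i j m n :: nat
proof -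
  have "(j - 1) * m + i \<le> (j - 1) * m + m"
    using that by simp
  also have "\<dots> = j * m"
    using that by (cases j) auto
  also have "\<dots> \<le> m * n"
    using that by simp
  finally show ?thesis .
qed

lemma digits_unique:
  fixes i i' j j' m :: nat
  assumes "(j - 1) * m + i = (j' - 1) * m + i'" "i \<in> {1..m}" "i' \<in> {1..m}" "j \<ge> 1" "j' \<ge> 1"
  shows "i = i' \<and> j = j'"
proof -
  have aux: "\<not> x < y" if "x * m + i = y * m + i'" "i \<le> m" "i' \<ge> 1" for x y i i' :: nat
  proof
    assume "x < y"
    then have "(x + 1) * m \<le> y * m"
      by (intro mult_right_mono) auto
    then show False
      using that by simp
  qed
  have "j - 1 = j' - 1"
    using aux[of "j - 1" i "j' - 1" i'] aux[of "j' - 1" i' "j - 1" i] assms by fastforce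
  then show ?thesis
    using assms by auto
qed

lemma digits_exist:
  fixes t m n :: nat
  assumes "t \<in> {1..m * n}"
  obtains i j where "i \<in> {1..m}" "j \<in> {1..n}" "t = (j - 1) * m + i"
proof
  have "m > 0"
    using assms by (cases m) auto
  then show "(t - 1) mod m + 1 \<in> {1..m}"
    by (simp add: Suc_le_eq)
  have "(t - 1) div m < n"
    using assms by (intro less_mult_imp_div_less) (auto simp: mult.commute)
  then show "(t - 1) div m + 1 \<in> {1..n}"
    by simp
  show "t = ((t - 1) div m + 1 - 1) * m + ((t - 1) mod m + 1)"
    using assms by simp
qed

lemma star_arcs_wheel:
  assumes "m \<ge> 3"
  shows "star_arcs (wheel_graph m) n =
     (\<lambda>(i, j). (0, i, j)) ` ({1..m} \<times> {1..n}) \<union> (\<lambda>(i, j). (i, 0, j)) ` ({1..m} \<times> {1..n})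
     \<union> (\<lambda>(i, j). (i, rim_succ m i, j)) ` ({1..m} \<times> {1..n})
     \<union> (\<lambda>(i, j). (i, rim_pred m i, j)) ` ({1..m} \<times> {1..n})" (is "_ = ?R")
proof -
  have "(a, b, j) \<in> star_arcs (wheel_graph m) n \<longleftrightarrow> (a, b, j) \<in> ?R" for a b j
  proof -
    consider "a = 0" | "a \<in> {1..m}" | "a > m"
      by fastforce
    then show ?thesis
      by cases (auto simp: star_arcs_def neighbours_wheel_hub neighbours_wheel_rim
          neighbours_wheel_outside assms)
  qed
  then show ?thesis
    by (simp only: set_eq_iff split_paired_All simp_thms)
qed

text \<open>
  There are at most \<open>4 m n\<close> arcs, so it is enough that every number up to \<open>4 m n\<close> is a label;
  injectivity and the exact number of arcs then follow by counting.
\<close>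
lemma wheel_star_label_bij:
  assumes m: "m \<ge> 3" and c: "c < 3"
  shows "bij_betw (wheel_star_label m n c) (star_arcs (wheel_graph m) n)
           {1..card (star_arcs (wheel_graph m) n)}"
proof -
  let ?A = "star_arcs (wheel_graph m) n" and ?g = "wheel_star_label m n c" and ?N = "m * n"
  let ?P = "{1..m} \<times> {1..n}"
  have fin: "finite ?A"
    by (simp add: star_arcs_wheel m)
  have card_le: "card ?A \<le> 4 * ?N"
  proof -
    have le: "card (h ` ?P) \<le> ?N" for h :: "nat \<times> nat \<Rightarrow> nat \<times> nat \<times> nat"
      using card_image_le[of ?P h] by simp
    have union: "card (W \<union> X \<union> Y \<union> Z) \<le> 4 * ?N"
      if "card W \<le> ?N" "card X \<le> ?N" "card Y \<le> ?N" "card Z \<le> ?N"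
      for W X Y Z :: "(nat \<times> nat \<times> nat) set"
      using that card_Un_le[of "W \<union> X \<union> Y" Z] card_Un_le[of "W \<union> X" Y] card_Un_le[of W X]
      by linarith
    show ?thesis
      unfolding star_arcs_wheel[OF m] by (intro union le)
  qed
  have onto: "{1..4 * ?N} \<subseteq> ?g ` ?A"
  proof
    fix t
    assume "t \<in> {1..4 * ?N}"
    then have "t \<in> {1..?N * 4}"
      by (simp add: mult.commute)
    then obtain s k' where k': "s \<in> {1..?N}" "k' \<in> {1..4}" "t = (k' - 1) * ?N + s"
      by (rule digits_exist)
    define k where "k = k' - 1"
    have t: "t = k * ?N + s" "k < 4" and s: "s \<in> {1..?N}"
      using k' by (auto simp: k_def)
    have "k = 3 \<or> k = c \<or> k = (c + 1) mod 3 \<or> k = (c + 2) mod 3"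
      using t(2) c by presburger
    then consider "k = 3" | "k = c" | "k = (c + 1) mod 3" | "k = (c + 2) mod 3"
      by blast
    then show "t \<in> ?g ` ?A"
    proof cases
      case 1
      obtain i j where ij: "i \<in> {1..m}" "j \<in> {1..n}" "s = (j - 1) * m + i"
        using s by (rule digits_exist)
      have "t = ?g (0, rim_pred m i, j)"
        using t 1 ij by (simp add: wheel_star_label_def rim_succ_pred)
      moreover have "(0, rim_pred m i, j) \<in> ?A"
        using ij rim_pred_in[OF ij(1)] by (simp add: star_arcs_def neighbours_wheel_hub m)
      ultimately show ?thesis
        by (rule image_eqI)
    next
      case 2
      have "s \<in> {1..n * m}"
        using s by (simp add: mult.commute)
      then obtain i j where ij: "j \<in> {1..n}" "i \<in> {1..m}" "s = (i - 1) * n + j"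
        by (rule digits_exist)
      have "t = ?g (i, 0, j)"
        using t 2 ij by (simp add: wheel_star_label_def)
      moreover have "(i, 0, j) \<in> ?A"
        using ij by (simp add: star_arcs_def neighbours_wheel_rim m)
      ultimately show ?thesis
        by (rule image_eqI)
    next
      case 3
      obtain i j where ij: "i \<in> {1..m}" "j \<in> {1..n}" "s = (j - 1) * m + i"
        using s by (rule digits_exist)
      have "t = ?g (i, rim_succ m i, j)"
        using t 3 ij rim_succ_in[OF ij(1)] by (simp add: wheel_star_label_def)
      moreover have "(i, rim_succ m i, j) \<in> ?A"
        using ij by (simp add: star_arcs_def neighbours_wheel_rim m)
      ultimately show ?thesis
        by (rule image_eqI)
    next
      case 4
      have "?N + 1 - s \<in> {1..?N}"
        using s by auto
      then obtain i j where ij: "i \<in> {1..m}" "j \<in> {1..n}" "?N + 1 - s = (j - 1) * m + i"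
        by (rule digits_exist)
      have "?N + 1 - ((j - 1) * m + i) = s"
        using ij(3)[symmetric] s by simp
      then have "t = ?g (i, rim_pred m i, j)"
        using t 4 ij rim_pred_in[OF ij(1)] rim_succ_neq_pred[OF m ij(1)]
        by (simp add: wheel_star_label_def)
      moreover have "(i, rim_pred m i, j) \<in> ?A"
        using ij by (simp add: star_arcs_def neighbours_wheel_rim m)
      ultimately show ?thesis
        by (rule image_eqI)
    qed
  qed
  have "4 * ?N \<le> card (?g ` ?A)"
    using card_mono[OF _ onto] fin by simp
  then have card: "card ?A = 4 * ?N" "card (?g ` ?A) = card ?A"
    using card_le card_image_le[OF fin, of ?g] by auto
  have "?g ` ?A = {1..4 * ?N}"
    using card_subset_eq[OF _ onto] fin card by simp
  moreover have "inj_on ?g ?A"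
    using fin card(2) by (simp add: eq_card_imp_inj_on)
  ultimately show ?thesis
    using card(1) by (simp add: bij_betw_def)
qed

section \<open>The vertex sums\<close>

text \<open>
  The three lower blocks all contribute, one label each, for every leaf. Their offsets add up to
  \<open>3 m n\<close> whatever \<open>c\<close> is, and the complementary rim positions to \<open>m n + 1\<close>.
\<close>
lemma sum_rim_centre:
  assumes m: "m \<ge> 3" and c: "c < 3" and i: "i \<in> {1..m}"
  shows "(\<Sum>j = 1..n. \<Sum>b \<in> neighbours (wheel_graph m) i. wheel_star_label m n c (i, b, j))
       = n * (4 * (m * n) + 1) + (i - 1) * n\<^sup>2 + \<Sum>{1..n}"
proof -
  have "(\<Sum>b \<in> neighbours (wheel_graph m) i. wheel_star_label m n c (i, b, j))
      = 4 * (m * n) + 1 + (i - 1) * n + j" if j: "j \<in> {1..n}" for j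
  proof -
    have blocks: "c + (c + 1) mod 3 + (c + 2) mod 3 = 3"
      using c by presburger
    have "c * (m * n) + (c + 1) mod 3 * (m * n) + (c + 2) mod 3 * (m * n) = 3 * (m * n)"
      by (simp only: distrib_right[symmetric] blocks)
    then show ?thesis
      using digits_le[OF i j] i rim_succ_in[OF i] rim_pred_in[OF i] rim_succ_neq_pred[OF m i]
      by (simp add: neighbours_wheel_rim[OF m i] wheel_star_label_def)
  qed
  then have "(\<Sum>j = 1..n. \<Sum>b \<in> neighbours (wheel_graph m) i. wheel_star_label m n c (i, b, j))
      = (\<Sum>j = 1..n. (4 * (m * n) + 1 + (i - 1) * n) + j)"
    by (intro sum.cong) auto
  also have "\<dots> = n * (4 * (m * n) + 1 + (i - 1) * n) + \<Sum>{1..n}"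
    by (simp only: sum.distrib sum_constant) (simp add: distrib_left)
  also have "\<dots> = n * (4 * (m * n) + 1) + (i - 1) * n\<^sup>2 + \<Sum>{1..n}"
    by (simp only: distrib_left power2_eq_square ac_simps)
  finally show ?thesis .
qed

text \<open>
  The position of the successor of \<open>k\<close> occurs twice, added on the arc from the hub and subtracted
  on the backward arc into \<open>k\<close>. What is left is the position of the predecessor, so that these
  sums run through an interval of consecutive numbers.
\<close>
lemma sum_rim_leaf:
  assumes m: "m \<ge> 3" and c: "c < 3" and k: "k \<in> {1..m}" and j: "j \<in> {1..n}"
  shows "(\<Sum>a \<in> neighbours (wheel_graph m) k. wheel_star_label m n c (a, k, j))
       = (7 - c) * (m * n) + 1 + ((j - 1) * m + rim_pred m k)"
proof -
  have blocks: "(c + 1) mod 3 + (c + 2) mod 3 + 3 + 1 = 7 - c"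
    using c by presburger
  have "(c + 1) mod 3 * (m * n) + (c + 2) mod 3 * (m * n) + 3 * (m * n) + 1 * (m * n)
      = (7 - c) * (m * n)"
    by (simp only: distrib_right[symmetric] blocks)
  \<comment> \<open>Hence the arc from the successor into \<open>k\<close> is a backward arc and not a forward one.\<close>
  moreover have "k \<noteq> rim_succ m (rim_succ m k)"
    using m k by (auto simp: rim_succ_def split: if_splits)
  moreover have "(j - 1) * m + rim_succ m k \<le> m * n"
    by (rule digits_le[OF rim_succ_in[OF k] j])
  ultimately show ?thesis
    using k rim_succ_in[OF k] rim_pred_in[OF k] rim_succ_neq_pred[OF m k]
    by (simp add: neighbours_wheel_rim[OF m k] wheel_star_label_def rim_succ_pred)
qed

lemma sum_hub_leaf:
  assumes m: "m \<ge> 3"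
  shows "(\<Sum>a \<in> neighbours (wheel_graph m) 0. wheel_star_label m n c (a, 0, j))
       = m * (c * (m * n)) + n * \<Sum>{0..<m} + m * j"
proof -
  have "(\<Sum>a \<in> neighbours (wheel_graph m) 0. wheel_star_label m n c (a, 0, j))
      = (\<Sum>a = 1..m. c * (m * n) + (a - 1) * n + j)"
    unfolding neighbours_wheel_hub[OF m] by (intro sum.cong) (auto simp: wheel_star_label_def)
  also have "\<dots> = (\<Sum>a = 0..<m. c * (m * n) + a * n + j)"
    by (intro sum.reindex_bij_witness[of _ Suc "\<lambda>a. a - 1"]) auto
  finally show ?thesis
    by (simp add: sum.distrib sum_distrib_left mult.commute)
qed

text \<open>A crude bound, from the top block alone, that already exceeds every other vertex sum.\<close>
lemma sum_hub_centre:
  assumes m: "m \<ge> 3" and n: "n \<ge> 1"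
  shows "3 * (m * n)\<^sup>2
       < (\<Sum>j = 1..n. \<Sum>b \<in> neighbours (wheel_graph m) 0. wheel_star_label m n c (0, b, j))"
proof -
  have "3 * (m * n)\<^sup>2 < (\<Sum>j = 1..n. \<Sum>b = 1..m. 3 * (m * n) + 1)"
    using m n by (simp add: power2_eq_square)
  also have "\<dots> \<le> (\<Sum>j = 1..n. \<Sum>b = 1..m. wheel_star_label m n c (0, b, j))"
    by (intro sum_mono) (auto simp: wheel_star_label_def rim_succ_def)
  finally show ?thesis
    by (simp add: neighbours_wheel_hub[OF m])
qed

section \<open>Separating the classes of vertices\<close>

lemma rim_centre_bounds:
  fixes m n i :: nat
  assumes "i \<in> {1..m}" "n \<ge> 1"
  defines "A \<equiv> n * (4 * (m * n) + 1) + (i - 1) * n\<^sup>2 + \<Sum>{1..n}"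
  shows "4 * (n * (m * n)) + n < A" "A \<le> 5 * (n * (m * n)) + n"
proof -
  have "\<Sum>{1..n} \<le> n\<^sup>2"
    using sum_bounded_above[of "{1..n}" "\<lambda>k. k" n] by (simp add: power2_eq_square)
  moreover have "\<Sum>{1..n} \<ge> n"
    using sum_bounded_below[of "{1..n}" 1 "\<lambda>k. k"] by simp
  moreover have "(i - 1) * n\<^sup>2 + n\<^sup>2 \<le> n * (m * n)"
  proof -
    have "(i - 1) * n\<^sup>2 + n\<^sup>2 = i * n\<^sup>2"
      using assms(1) by (cases i) auto
    also have "\<dots> \<le> m * n\<^sup>2"
      using assms(1) by simp
    finally show ?thesis
      by (simp add: power2_eq_square mult.left_commute)
  qed
  moreover have "n * (4 * (m * n) + 1) = 4 * (n * (m * n)) + n"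
    by (simp add: distrib_left)
  ultimately show "4 * (n * (m * n)) + n < A" "A \<le> 5 * (n * (m * n)) + n"
    using assms(2) unfolding A_def by linarith+
qed

lemma hub_leaf_bounds:
  fixes m n c j :: nat
  assumes "m \<ge> 1" "j \<in> {1..n}"
  defines "C \<equiv> m * (c * (m * n)) + n * \<Sum>{0..<m} + m * j"
  shows "(2 * c + 1) * (m * (m * n)) + 2 * m \<le> 2 * C + m * n"
    and "2 * C \<le> (2 * c + 1) * (m * (m * n)) + m * n"
proof -
  \<comment> \<open>Doubling Gauss' sum keeps the computation free of division.\<close>
  have "2 * \<Sum>{0..<m} + m = m * m"
    by (induction m) auto
  then have "n * (2 * \<Sum>{0..<m} + m) = n * (m * m)"
    by (rule arg_cong)
  then have "2 * (n * \<Sum>{0..<m}) + m * n = m * (m * n)"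
    by (simp add: algebra_simps)
  moreover have "m \<le> m * j" "m * j \<le> m * n"
    using assms(2) by auto
  moreover have "2 * C = 2 * c * (m * (m * n)) + 2 * (n * \<Sum>{0..<m}) + 2 * (m * j)"
    by (simp add: C_def distrib_left mult.left_commute)
  moreover have "(2 * c + 1) * (m * (m * n)) = 2 * c * (m * (m * n)) + m * (m * n)"
    by simp
  ultimately show "(2 * c + 1) * (m * (m * n)) + 2 * m \<le> 2 * C + m * n"
    and "2 * C \<le> (2 * c + 1) * (m * (m * n)) + m * n"
    by presburger+
qed

lemma rim_leaf_bounds:
  fixes m n c j k :: nat
  assumes "k \<in> {1..m}" "j \<in> {1..n}" "c < 3"
  defines "B \<equiv> (7 - c) * (m * n) + 1 + ((j - 1) * m + rim_pred m k)"
  shows "(7 - c) * (m * n) + 1 < B" "B \<le> (8 - c) * (m * n) + 1"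
proof -
  have "(8 - c) * (m * n) = (7 - c) * (m * n) + m * n"
    using assms(3) by (simp add: diff_mult_distrib)
  then show "(7 - c) * (m * n) + 1 < B" "B \<le> (8 - c) * (m * n) + 1"
    using digits_le[OF rim_pred_in[OF assms(1)] assms(2)] rim_pred_in[OF assms(1)]
    by (auto simp: B_def)
qed

text \<open>
  The value \<open>1\<close> puts the sums at the copies of the hub between the other two groups:
  \<open>m \<le> 2 n\<close> leaves room above them and \<open>m \<ge> 5\<close> room below (for \<open>m = 4\<close>, \<open>n = 2\<close> it would produce a
  coincidence).
\<close>
definition middle_block :: "nat \<Rightarrow> nat \<Rightarrow> nat" where
  "middle_block m n = (if m \<le> 4 then 0 else if m \<le> 2 * n then 1 else 2)"

text \<open>
  Here \<open>A\<close>, \<open>B\<close> and \<open>C\<close> stand for arbitrary sums at \<open>(i, 0)\<close>, at \<open>(k, j)\<close> and at \<open>(0, j)\<close>.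
  For \<open>n = 1\<close> the order is \<open>A < B\<close>, as \<open>A\<close> stays within \<open>5 N + 1\<close> and \<open>c \<le> 2\<close>; for \<open>n \<ge> 2\<close> it
  is \<open>B < A\<close>, as then \<open>4 N n \<ge> 8 N\<close>.
\<close>
lemma middle_block_separates:
  fixes m n A B C :: nat
  assumes m: "m \<ge> 3" and n: "n \<ge> 1"
  defines "c \<equiv> middle_block m n"
  assumes A: "4 * (n * (m * n)) + n < A" "A \<le> 5 * (n * (m * n)) + n"
    and B: "(7 - c) * (m * n) + 1 < B" "B \<le> (8 - c) * (m * n) + 1"
    and C: "(2 * c + 1) * (m * (m * n)) + 2 * m \<le> 2 * C + m * n"
      "2 * C \<le> (2 * c + 1) * (m * (m * n)) + m * n"
  shows "A \<noteq> B" "A \<noteq> C" "B \<noteq> C"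
    and "A \<le> 3 * (m * n)\<^sup>2" "B \<le> 3 * (m * n)\<^sup>2" "C \<le> 3 * (m * n)\<^sup>2"
proof -
  define N where "N = m * n"
  have c: "c = 0 \<and> m \<le> 4 \<or> c = 1 \<and> 5 \<le> m \<and> m \<le> 2 * n \<or> c = 2 \<and> 5 \<le> m \<and> 2 * n + 1 \<le> m"
    by (auto simp: c_def middle_block_def)
  note A = A[folded N_def] and B = B[folded N_def] and C = C[folded N_def]
  have N: "3 * n \<le> N" "m \<le> N" "n \<le> N"
    using m n by (auto simp: N_def)
  have nN: "N \<le> n * N"
    using n by simp
  have mono: "x * N \<le> y * N" if "x \<le> y" for x y
    using that by simp
  show "A \<noteq> B"
  proof (cases "n = 1")
    case True
    have "5 * N \<le> (7 - c) * N"
      by (rule mono) (use c in auto)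
    moreover have "A \<le> 5 * N + 1"
      using A(2) True by simp
    ultimately show ?thesis
      using B(1) by linarith
  next
    case False
    have "8 - c \<le> 4 * n"
      using False n by linarith
    from mono[OF this] have "(8 - c) * N \<le> 4 * (n * N)"
      by (simp add: mult.assoc)
    then show ?thesis
      using A B n by linarith
  qed
  have C0: "2 * C \<le> 5 * N" if "c = 0" "m \<le> 4"
    using C(2) mono[OF that(2)] that(1) by (simp only: mult_0_right add_0 mult_1)
  have C1: "2 * C \<le> 3 * (m * N) + N" "3 * (m * N) + 2 * m \<le> 2 * C + N" if "c = 1"
    using C that by simp_all
  have C2: "5 * (m * N) + 2 * m \<le> 2 * C + N" if "c = 2"
    using C(1) that by simp
  show "A \<noteq> C"
    using c
  proof (elim disjE conjE)
    assume "c = 0" "m \<le> 4"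
    then show ?thesis
      using C0 A(1) nN n by linarith
  next
    assume "c = 1" "m \<le> 2 * n"
    from mono[OF this(2)] have "m * N \<le> 2 * (n * N)"
      by (simp only: mult.assoc)
    then show ?thesis
      using C1(1)[OF \<open>c = 1\<close>] A(1) nN by linarith
  next
    assume "c = 2" "2 * n + 1 \<le> m"
    from mono[OF this(2)] have "2 * (n * N) + N \<le> m * N"
      by (simp only: distrib_right mult.assoc mult_1)
    then show ?thesis
      using C2[OF \<open>c = 2\<close>] A(2) N n by linarith
  qed
  show "B \<noteq> C"
    using c
  proof (elim disjE conjE)
    assume "c = 0" "m \<le> 4"
    then show ?thesis
      using C0 B(1) by simp
  next
    assume "c = 1" "5 \<le> m"
    moreover from this have "B \<le> 7 * N + 1"
      using B(2) by simp
    ultimately show ?thesis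
      using C1(2)[OF \<open>c = 1\<close>] mono[OF \<open>5 \<le> m\<close>] N by linarith
  next
    assume "c = 2" "5 \<le> m"
    moreover from this have "B \<le> 6 * N + 1"
      using B(2) by simp
    ultimately show ?thesis
      using C2[OF \<open>c = 2\<close>] mono[OF \<open>5 \<le> m\<close>] N by linarith
  qed
  have "3 * (n * N) \<le> N * N" "m * N \<le> N * N" "3 * N \<le> N * N"
    using mono[of "3 * n" N] mono[of m N] mono[of 3 N] N n by auto
  moreover have "N \<le> m * N" "n \<le> n * N" "1 \<le> N"
    using N n m by auto
  moreover have "(8 - c) * N \<le> 8 * N"
    by (rule mono) simp
  moreover have "(2 * c + 1) * (m * N) \<le> 5 * (m * N)"
    by (rule mult_right_mono) (use c in auto)
  ultimately show "A \<le> 3 * (m * n)\<^sup>2" "B \<le> 3 * (m * n)\<^sup>2" "C \<le> 3 * (m * n)\<^sup>2"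
    using A(2) B(2) C(2) unfolding power2_eq_square N_def[symmetric] by linarith+
qed

theorem theorem4:
  fixes m n :: nat
  assumes "m \<ge> 3" and "n \<ge> 1"
  shows "antimagic (tensor_product (wheel_graph m) (star_graph n))"
proof -
  let ?W = "wheel_graph m"
  define c where "c = middle_block m n"
  have c: "c < 3"
    by (simp add: c_def middle_block_def)
  define val where "val = (\<lambda>(a, j).
    if j = 0 then \<Sum>i = 1..n. \<Sum>b \<in> neighbours ?W a. wheel_star_label m n c (a, b, i)
    else \<Sum>b \<in> neighbours ?W a. wheel_star_label m n c (b, a, j))"
  define A where "A i = n * (4 * (m * n) + 1) + (i - 1) * n\<^sup>2 + \<Sum>{1..n}" for i
  define B where "B k j = (7 - c) * (m * n) + 1 + ((j - 1) * m + rim_pred m k)" for k j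
  define C where "C j = m * (c * (m * n)) + n * \<Sum>{0..<m} + m * j" for j
  define D where "D = val (0, 0)"
  have val: "val (i, 0) = A i" "j \<in> {1..n} \<Longrightarrow> val (i, j) = B i j" if "i \<in> {1..m}" for i j
    using that sum_rim_centre[OF assms(1) c that] sum_rim_leaf[OF assms(1) c that]
    by (auto simp: val_def A_def B_def)
  have val_hub: "val (0, j) = C j" if "j \<in> {1..n}" for j
    using that sum_hub_leaf[OF assms(1)] by (auto simp: val_def C_def)
  have A: "4 * (n * (m * n)) + n < A i" "A i \<le> 5 * (n * (m * n)) + n" if "i \<in> {1..m}" for i
    using rim_centre_bounds[OF that assms(2)] by (simp_all add: A_def)
  have B: "(7 - c) * (m * n) + 1 < B k j" "B k j \<le> (8 - c) * (m * n) + 1"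
    if "k \<in> {1..m}" "j \<in> {1..n}" for k j
    using rim_leaf_bounds[OF that c] by (simp_all add: B_def)
  have C: "(2 * c + 1) * (m * (m * n)) + 2 * m \<le> 2 * C j + m * n"
    "2 * C j \<le> (2 * c + 1) * (m * (m * n)) + m * n" if "j \<in> {1..n}" for j
    using hub_leaf_bounds[OF _ that, of m c] assms(1) by (simp_all add: C_def)
  have sep: "A i \<noteq> B k j \<and> A i \<noteq> C l \<and> B k j \<noteq> C l \<and> A i < D \<and> B k j < D \<and> C l < D"
    if "i \<in> {1..m}" "k \<in> {1..m}" "j \<in> {1..n}" "l \<in> {1..n}" for i k j l
    using middle_block_separates[OF assms A[OF that(1)] B[OF that(2,3), unfolded c_def]
        C[OF that(4), unfolded c_def]] sum_hub_centre[OF assms, of c]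
    by (auto simp: D_def val_def)
  have one: "1 \<in> {1..m}" "1 \<in> {1..n}"
    using assms by auto
  have neq: "i \<in> {1..m} \<Longrightarrow> k \<in> {1..m} \<Longrightarrow> j \<in> {1..n} \<Longrightarrow> A i \<noteq> B k j"
    "i \<in> {1..m} \<Longrightarrow> j \<in> {1..n} \<Longrightarrow> A i \<noteq> C j"
    "k \<in> {1..m} \<Longrightarrow> j \<in> {1..n} \<Longrightarrow> l \<in> {1..n} \<Longrightarrow> B k j \<noteq> C l"
    "i \<in> {1..m} \<Longrightarrow> A i \<noteq> D" "k \<in> {1..m} \<Longrightarrow> j \<in> {1..n} \<Longrightarrow> B k j \<noteq> D"
    "l \<in> {1..n} \<Longrightarrow> C l \<noteq> D" for i j k l
    using sep one by (blast, blast, blast, (metis less_irrefl)+)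
  note neq = neq neq[symmetric]
  have A_inj: "i = i'" if "A i = A i'" "i \<in> {1..m}" "i' \<in> {1..m}" for i i'
    using that assms(2) by (auto simp: A_def)
  have B_inj: "k = k' \<and> j = j'"
    if "B k j = B k' j'" "k \<in> {1..m}" "k' \<in> {1..m}" "j \<in> {1..n}" "j' \<in> {1..n}" for k k' j j'
  proof -
    have "rim_pred m k = rim_pred m k' \<and> j = j'"
      using that by (intro digits_unique[OF _ rim_pred_in rim_pred_in]) (auto simp: B_def)
    then show ?thesis
      using that rim_succ_pred by metis
  qed
  have C_inj: "j = j'" if "C j = C j'" for j j'
    using that assms(1) by (auto simp: C_def)
  have "inj_on val (verts ?W \<times> {0..n})"
  proof (rule inj_onI, clarify)
    fix a j a' j'
    assume "val (a, j) = val (a', j')" "a \<in> verts ?W" "a' \<in> verts ?W" "j \<in> {0..n}" "j' \<in> {0..n}"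
    then have eq: "val (a, j) = val (a', j')"
      and a: "a = 0 \<or> a \<in> {1..m}" "a' = 0 \<or> a' \<in> {1..m}"
      and j: "j = 0 \<or> j \<in> {1..n}" "j' = 0 \<or> j' \<in> {1..n}"
      by (auto simp: wheel_graph_def)
    show "a = a' \<and> j = j'"
      using a j eq by (elim disjE) (auto simp: val val_hub D_def[symmetric] neq
          dest: A_inj B_inj C_inj simp del: atLeastAtMost_iff)
  qed
  then show ?thesis
    unfolding val_def by (rule antimagic_tensor_star[OF wheel_star_label_bij[OF assms(1) c]])
qed

end
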